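(* For each integer $\ell\geq 4$, if $G$ is the gear graph $G_{2\ell+1}$ or the accordion graph $A_{2\ell}$, then $\operatorname{th}_d(G)=\operatorname{th}_c(G)-2$. Consequently, there exist infinitely many connected graphs $G$ with $\operatorname{th}_d(G) < \operatorname{th}_c(G) - 1$.
   Context: The gear graph $G_{2\ell+1}$ is obtained from the wheel $W_{2\ell+1}$ (a cycle $C_{2\ell}$ plus a hub vertex adjacent to all cycle vertices) by deleting every other edge incident to the hub, so the hub is adjacent to alternate vertices of the cycle. The accordion graph $A_{2\ell}$ is obtained from the fan $F_{2\ell}$ (a path $P_{2\ell-1}$ plus a vertex adjacent to all path vertices) by deleting every other edge incident to that dominating vertex, so it remains adjacent to alternate vertices along the path. Cops and Robbers on a finite simple graph with $n$ vertices: in round $0$ each of $k$ cops and then the robber choose a vertex; in each later round each cop stays or moves along an edge, then the robber does the same; capture occurs when a cop occupies the robber's vertex. $\operatorname{capt}_k(G)$ is the minimum number of rounds for $k$ cops to capture a robber who evades as long as possible ($\infty$ if $k$ is less than the cop number). A vertex is damaged if the robber occupies it in a round in which capture does not occur; $\operatorname{dmg}_k(G)$ is the minimum number of damaged vertices over games with $k$ cops when the robber maximizes damage. $\operatorname{th}_c(G)=\min_{1\le k\le n}\{k+\operatorname{capt}_k(G)\}$, $\operatorname{th}_d(G)=\min_{1\le k\le n}\{k+\operatorname{dmg}_k(G)\}$. *)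

theory Defs
  imports "Graph_Theory.Graph_Theory" "HOL-Library.Extended_Nat"
begin

text \<open>Finite simple graphs are \<^locale>\<open>pair_graph\<close>s: each edge is a symmetric pair of arcs.\<close>

definition graph_of :: "'a set \<Rightarrow> 'a rel \<Rightarrow> 'a pair_pre_digraph" where
  "graph_of V E = \<lparr> pverts = V, parcs = E \<union> E\<inverse> \<rparr>"

text \<open>The gear graph on \<open>2 * l + 1\<close> vertices: cycle \<open>0, \<dots>, 2 * l - 1\<close>, hub \<open>2 * l\<close>.
  Deleting the other alternate half of the spokes gives the same graph up to rotation.\<close>

definition gear_graph :: "nat \<Rightarrow> nat pair_pre_digraph" where
  "gear_graph l = graph_of {..2 * l}
     ({(i, Suc i mod (2 * l)) | i. i < 2 * l} \<union> {(2 * l, i) | i. i < 2 * l \<and> even i})"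

text \<open>The accordion graph on \<open>2 * l\<close> vertices: path \<open>0, \<dots>, 2 * l - 2\<close>, hub \<open>2 * l - 1\<close>.
  Here the two ways to delete every other spoke give different graphs: for \<open>b = True\<close> the hub
  remains adjacent to the ends of the path, for \<open>b = False\<close> it does not.\<close>

definition accordion_graph :: "bool \<Rightarrow> nat \<Rightarrow> nat pair_pre_digraph" where
  "accordion_graph b l = graph_of {..<2 * l}
     ({(i, Suc i) | i. Suc i < 2 * l - 1} \<union>
      {(2 * l - 1, i) | i. i < 2 * l - 1 \<and> (even i \<longleftrightarrow> b)})"

definition move :: "'a pair_pre_digraph \<Rightarrow> 'a \<Rightarrow> 'a \<Rightarrow> bool" where
  "move G u v \<longleftrightarrow> u = v \<or> (u, v) \<in> parcs G"

text \<open>A play of the robber: \<open>r t\<close> is his position at the end of round \<open>t\<close>. Plays are infinite;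
  what happens after a capture has no influence on the quantities below.\<close>

definition robber_play :: "'a pair_pre_digraph \<Rightarrow> (nat \<Rightarrow> 'a) \<Rightarrow> bool" where
  "robber_play G r \<longleftrightarrow> r 0 \<in> pverts G \<and> (\<forall>t. move G (r t) (r (Suc t)))"

text \<open>A strategy of the cops maps the list of the robber's positions in all earlier rounds to the
  list of the cops' positions; the empty history yields the initial placement. The cops' own past
  positions are determined by the strategy and the robber's history.\<close>

type_synonym 'a cop_strategy = "'a list \<Rightarrow> 'a list"

definition cops_at :: "'a cop_strategy \<Rightarrow> (nat \<Rightarrow> 'a) \<Rightarrow> nat \<Rightarrow> 'a list" where
  "cops_at \<sigma> r t = \<sigma> (map r [0..<t])"

definition cop_strategies :: "'a pair_pre_digraph \<Rightarrow> nat \<Rightarrow> 'a cop_strategy set" where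
  "cop_strategies G k = {\<sigma>. \<forall>r. robber_play G r \<longrightarrow>
     length (cops_at \<sigma> r 0) = k \<and> set (cops_at \<sigma> r 0) \<subseteq> pverts G \<and>
     (\<forall>t. list_all2 (move G) (cops_at \<sigma> r t) (cops_at \<sigma> r (Suc t)))}"

text \<open>In round \<open>t\<close> the robber is captured by his own move to (or choice of) an occupied vertex,
  or, before that, by a cop moving onto the vertex where he stood after round \<open>t - 1\<close>.\<close>

definition captured_in :: "'a cop_strategy \<Rightarrow> (nat \<Rightarrow> 'a) \<Rightarrow> nat \<Rightarrow> bool" where
  "captured_in \<sigma> r t \<longleftrightarrow>
     r t \<in> set (cops_at \<sigma> r t) \<or> (t > 0 \<and> r (t - 1) \<in> set (cops_at \<sigma> r t))"

definition capture_round :: "'a cop_strategy \<Rightarrow> (nat \<Rightarrow> 'a) \<Rightarrow> enat" where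
  "capture_round \<sigma> r = (INF t \<in> {t. captured_in \<sigma> r t}. enat t)"

text \<open>A vertex is damaged if the robber stands on it when some round \<open>t + 1\<close> begins and he is not
  captured in that round. A vertex the robber enters only to be captured there by the cops' next
  move is thus not damaged, which is the usual convention for the damage number.\<close>

definition damaged :: "'a cop_strategy \<Rightarrow> (nat \<Rightarrow> 'a) \<Rightarrow> 'a set" where
  "damaged \<sigma> r = {r t | t. enat (Suc t) < capture_round \<sigma> r}"

definition capt :: "'a pair_pre_digraph \<Rightarrow> nat \<Rightarrow> enat" where
  "capt G k = (INF \<sigma> \<in> cop_strategies G k. SUP r \<in> {r. robber_play G r}. capture_round \<sigma> r)"

definition dmg :: "'a pair_pre_digraph \<Rightarrow> nat \<Rightarrow> enat" where
  "dmg G k = (INF \<sigma> \<in> cop_strategies G k.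
     SUP r \<in> {r. robber_play G r}. enat (card (damaged \<sigma> r)))"

definition th_c :: "'a pair_pre_digraph \<Rightarrow> enat" where
  "th_c G = (INF k \<in> {1..card (pverts G)}. enat k + capt G k)"

definition th_d :: "'a pair_pre_digraph \<Rightarrow> enat" where
  "th_d G = (INF k \<in> {1..card (pverts G)}. enat k + dmg G k)"

text \<open>Both throttling numbers of a nonempty finite graph are finite: a cop on every vertex
  captures the robber in round 0.\<close>

lemma
  assumes "pair_graph G" and "pverts G \<noteq> {}"
  shows th_c_le_card: "th_c G \<le> enat (card (pverts G))"
    and th_d_le_card: "th_d G \<le> enat (card (pverts G))"
proof -
  interpret pair_graph G by fact
  obtain xs where xs: "set xs = pverts G" "length xs = card (pverts G)"
    by (metis distinct_card finite_distinct_list pair_finite_verts)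
  define \<sigma> :: "'a cop_strategy" where "\<sigma> = (\<lambda>_. xs)"
  have strat: "\<sigma> \<in> cop_strategies G (card (pverts G))"
    using xs by (auto simp: cop_strategies_def cops_at_def \<sigma>_def move_def list_all2_same)
  have cap: "capture_round \<sigma> r = 0" if "robber_play G r" for r
  proof -
    have "captured_in \<sigma> r 0"
      using that xs by (auto simp: captured_in_def cops_at_def \<sigma>_def robber_play_def)
    then have "capture_round \<sigma> r \<le> enat 0"
      unfolding capture_round_def by (intro INF_lower) simp
    then show ?thesis by (simp add: zero_enat_def[symmetric])
  qed
  have "capt G (card (pverts G)) \<le> (SUP r \<in> {r. robber_play G r}. capture_round \<sigma> r)"
    unfolding capt_def by (rule INF_lower[OF strat])
  also have "\<dots> \<le> 0" by (rule SUP_least) (simp add: cap)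
  finally have c: "capt G (card (pverts G)) = 0" by simp
  have "dmg G (card (pverts G)) \<le> (SUP r \<in> {r. robber_play G r}. enat (card (damaged \<sigma> r)))"
    unfolding dmg_def by (rule INF_lower[OF strat])
  also have "\<dots> \<le> 0" by (rule SUP_least) (simp add: cap damaged_def zero_enat_def[symmetric])
  finally have d: "dmg G (card (pverts G)) = 0" by simp
  have n: "card (pverts G) \<in> {1..card (pverts G)}"
    using assms(2) pair_finite_verts by (simp add: Suc_leI card_gt_0_iff)
  show "th_c G \<le> enat (card (pverts G))"
    using INF_lower[OF n, of "\<lambda>k. enat k + capt G k"] c by (simp add: th_c_def)
  show "th_d G \<le> enat (card (pverts G))"
    using INF_lower[OF n, of "\<lambda>k. enat k + dmg G k"] d by (simp add: th_d_def)
qed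

end

theory Submission
  imports Defs
begin

text \<open>All graphs in question are bipartite with respect to \<open>A\<close> and \<open>insert h B\<close>, where \<open>A\<close> is the
  neighbourhood of the hub \<open>h\<close>, and for each of them \<open>th\<^sub>d = 2\<close> and \<open>th\<^sub>c = 4\<close>.
  A single cop waiting at the hub confines the robber to one vertex of \<open>B\<close>, since every vertex he
  can move to is adjacent to the hub. Capturing him is harder: a single cop cannot do it within two
  rounds, because the robber can dodge along 4-cycles, and two cops need more than one round,
  because no two vertices dominate the graph. Two cops starting at the hub capture him in round 2.\<close>

section \<open>Bounds for the number of rounds and the damage\<close>

lemma capture_round_le: "captured_in \<sigma> r t \<Longrightarrow> capture_round \<sigma> r \<le> enat t"
  unfolding capture_round_def by (rule INF_lower) simp

lemma enat_le_capture_round_iff: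
  "enat m \<le> capture_round \<sigma> r \<longleftrightarrow> (\<forall>t<m. \<not> captured_in \<sigma> r t)"
  unfolding capture_round_def le_INF_iff by (auto simp: not_less[symmetric])

text \<open>\<open>capt\<close> is an infimum over strategies of suprema over plays, so the robber
  may choose \<open>r\<close> knowing all of \<sigma>.\<close>

lemma le_captI:
  assumes "\<And>\<sigma>. \<sigma> \<in> cop_strategies G k \<Longrightarrow>
    \<exists>r. robber_play G r \<and> (\<forall>t<m. \<not> captured_in \<sigma> r t)"
  shows "enat m \<le> capt G k"
  unfolding capt_def
proof (rule INF_greatest)
  fix \<sigma> assume "\<sigma> \<in> cop_strategies G k"
  then obtain r where r: "robber_play G r" "\<forall>t<m. \<not> captured_in \<sigma> r t"
    using assms by blast
  then have "enat m \<le> capture_round \<sigma> r" by (simp add: enat_le_capture_round_iff)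
  with r(1) show "enat m \<le> (SUP r \<in> {r. robber_play G r}. capture_round \<sigma> r)"
    by (intro SUP_upper2[of r]) simp_all
qed

lemma capt_leI:
  assumes "\<sigma> \<in> cop_strategies G k" "\<And>r. robber_play G r \<Longrightarrow> \<exists>t\<le>m. captured_in \<sigma> r t"
  shows "capt G k \<le> enat m"
  unfolding capt_def
proof (rule INF_lower2[OF assms(1)], rule SUP_least)
  fix r assume "r \<in> {r. robber_play G r}"
  then obtain t where "t \<le> m" "captured_in \<sigma> r t" using assms(2) by blast
  then have "capture_round \<sigma> r \<le> enat t" "enat t \<le> enat m"
    by (simp_all add: capture_round_le)
  then show "capture_round \<sigma> r \<le> enat m" by (rule order_trans)
qed

lemma dmg_leI:
  assumes "\<sigma> \<in> cop_strategies G k" "\<And>r. robber_play G r \<Longrightarrow> card (damaged \<sigma> r) \<le> m"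
  shows "dmg G k \<le> enat m"
  unfolding dmg_def using assms(1)
  by (rule INF_lower2) (auto intro!: SUP_least simp: assms(2))

lemma cops_at_0: "cops_at \<sigma> r 0 = \<sigma> []"
  by (simp add: cops_at_def)

lemma robber_play_const: "v \<in> pverts G \<Longrightarrow> robber_play G (\<lambda>_. v)"
  by (simp add: robber_play_def move_def)

lemma cop_strategies_initial:
  assumes "\<sigma> \<in> cop_strategies G k" "robber_play G r"
  shows "length (\<sigma> []) = k" "set (\<sigma> []) \<subseteq> pverts G"
  using assms by (auto simp: cop_strategies_def cops_at_0)

lemma cop_strategies_step:
  assumes "\<sigma> \<in> cop_strategies G k" "robber_play G r"
  shows "list_all2 (move G) (cops_at \<sigma> r t) (cops_at \<sigma> r (Suc t))"
  using assms by (auto simp: cop_strategies_def)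

text \<open>Fewer cops than vertices leave some vertex unoccupied in round 0, and the robber starts
  there.\<close>

lemma one_le_capt:
  assumes "finite (pverts G)" "k < card (pverts G)"
  shows "1 \<le> capt G k"
  unfolding one_enat_def
proof (rule le_captI)
  fix \<sigma> assume \<sigma>: "\<sigma> \<in> cop_strategies G k"
  obtain v\<^sub>0 where v\<^sub>0: "v\<^sub>0 \<in> pverts G" using assms(2) by fastforce
  have "card (set (\<sigma> [])) < card (pverts G)"
    using cop_strategies_initial[OF \<sigma> robber_play_const[OF v\<^sub>0]] card_length[of "\<sigma> []"] assms(2)
    by simp
  then obtain v where "v \<in> pverts G" "v \<notin> set (\<sigma> [])"
    by (metis card_mono finite_set leD subsetI)
  then show "\<exists>r. robber_play G r \<and> (\<forall>t<1. \<not> captured_in \<sigma> r t)"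
    by (intro exI[of _ "\<lambda>_. v"]) (simp add: robber_play_const captured_in_def cops_at_0)
qed

text \<open>If no \<open>k\<close> vertices dominate the graph, the robber picks a vertex missed by
  the initial cops and stays: no cop is on it in round 0, and none can reach it in round 1.\<close>

lemma two_le_capt:
  assumes "pverts G \<noteq> {}"
    and "\<And>cs. length cs = k \<Longrightarrow> set cs \<subseteq> pverts G \<Longrightarrow>
           \<exists>v\<in>pverts G. \<forall>c\<in>set cs. \<not> move G c v"
  shows "2 \<le> capt G k"
  unfolding numeral_eq_enat
proof (rule le_captI)
  fix \<sigma> assume \<sigma>: "\<sigma> \<in> cop_strategies G k"
  obtain v\<^sub>0 where v\<^sub>0: "v\<^sub>0 \<in> pverts G" using assms(1) by blast
  obtain v where v: "v \<in> pverts G" "\<And>c. c \<in> set (\<sigma> []) \<Longrightarrow> \<not> move G c v"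
    using cop_strategies_initial[OF \<sigma> robber_play_const[OF v\<^sub>0]] assms(2) by metis
  let ?r = "\<lambda>_::nat. v"
  have r: "robber_play G ?r" using v(1) by (rule robber_play_const)
  have "v \<notin> set (cops_at \<sigma> ?r 1)"
    using cop_strategies_step[OF \<sigma> r, of 0] v(2)
    by (auto simp: cops_at_0 list_all2_conv_all_nth in_set_conv_nth[of v] dest: nth_mem)
  moreover have "v \<notin> set (cops_at \<sigma> ?r 0)"
    using v(2) by (auto simp: cops_at_0 move_def)
  ultimately show "\<exists>r. robber_play G r \<and> (\<forall>t<2. \<not> captured_in \<sigma> r t)"
    using r by (intro exI[of _ ?r]) (auto simp: captured_in_def less_2_cases_iff)
qed

text \<open>The robber starts at a vertex \<open>v\<close> out of the cop's reach, sees the cop's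
  move to \<open>c'\<close> in round 1, and answers with a \<open>v'\<close> out of reach of
  \<open>c'\<close>. The cop's move in round 2 therefore misses as well.\<close>

lemma three_le_capt_one_if_dodge:
  assumes ne: "pverts G \<noteq> {}"
    and esc: "\<And>c. c \<in> pverts G \<Longrightarrow> \<exists>v\<in>pverts G. \<not> move G c v \<and>
      (\<forall>c'. move G c c' \<longrightarrow> (\<exists>v'. move G v v' \<and> \<not> move G c' v'))"
  shows "3 \<le> capt G 1"
  unfolding numeral_eq_enat
proof (rule le_captI)
  fix \<sigma> assume \<sigma>: "\<sigma> \<in> cop_strategies G 1"
  obtain v\<^sub>0 where v\<^sub>0: "v\<^sub>0 \<in> pverts G" using ne by blast
  obtain c where c: "\<sigma> [] = [c]" "c \<in> pverts G"
    using cop_strategies_initial[OF \<sigma> robber_play_const[OF v\<^sub>0]]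
    by (auto simp: length_Suc_conv)
  obtain v where v: "v \<in> pverts G" "\<not> move G c v"
    "\<And>c'. move G c c' \<Longrightarrow> \<exists>v'. move G v v' \<and> \<not> move G c' v'"
    using esc[OF c(2)] by blast
  obtain c' where c': "\<sigma> [v] = [c']" "move G c c'"
    using cop_strategies_step[OF \<sigma> robber_play_const[OF v(1)], of 0] c(1)
    by (auto simp: cops_at_def list_all2_Cons1)
  obtain v' where v': "move G v v'" "\<not> move G c' v'"
    using v(3)[OF c'(2)] by blast
  define r where "r = (\<lambda>t::nat. if t = 0 then v else v')"
  have r: "robber_play G r"
    using v(1) v'(1) by (auto simp: robber_play_def r_def move_def)
  have at1: "cops_at \<sigma> r 1 = [c']"
    using c'(1) by (simp add: cops_at_def r_def)
  obtain c'' where c'': "cops_at \<sigma> r 2 = [c'']" "move G c' c''"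
    using cop_strategies_step[OF \<sigma> r, of 1] at1
    by (auto simp: list_all2_Cons1 numeral_2_eq_2)
  have "v \<noteq> c" "v' \<noteq> c'" using v(2) v'(2) by (auto simp: move_def)
  moreover have "v \<noteq> c'" "v' \<noteq> c''" using v(2) v'(2) c'(2) c''(2) by auto
  ultimately have "\<not> captured_in \<sigma> r 0" "\<not> captured_in \<sigma> r 1" "\<not> captured_in \<sigma> r 2"
    using c(1) at1 c''(1) by (auto simp: captured_in_def cops_at_0 r_def)
  then show "\<exists>r. robber_play G r \<and> (\<forall>t<3. \<not> captured_in \<sigma> r t)"
    using r by (intro exI[of _ r]) (auto simp: numeral_3_eq_3 less_Suc_eq numeral_2_eq_2)
qed

lemma robber_play_verts:
  assumes "pair_graph G" "robber_play G r"
  shows "r t \<in> pverts G"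
proof (induction t)
  case 0
  with assms(2) show ?case by (simp add: robber_play_def)
next
  case (Suc t)
  interpret pair_graph G by fact
  from Suc assms(2) show ?case
    unfolding robber_play_def move_def by (metis in_arcsD2)
qed

text \<open>A strategy ending every play by round 1 would contradict the bound on
  \<open>capt\<close>; in a play that lasts longer, the starting vertex is damaged.\<close>

lemma one_le_dmg:
  assumes G: "pair_graph G" and capt: "2 \<le> capt G k"
  shows "1 \<le> dmg G k"
  unfolding dmg_def
proof (rule INF_greatest)
  interpret pair_graph G by (rule G)
  fix \<sigma> assume \<sigma>: "\<sigma> \<in> cop_strategies G k"
  have "\<exists>r. robber_play G r \<and> 1 < capture_round \<sigma> r"
  proof (rule ccontr)
    assume "\<not> ?thesis"
    then have "capt G k \<le> 1"
      unfolding capt_def by (intro INF_lower2[OF \<sigma>] SUP_least) (auto simp: not_less)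
    with capt have "(2::enat) \<le> 1" by (rule order_trans)
    then show False by (simp add: one_enat_def numeral_eq_enat)
  qed
  then obtain r where r: "robber_play G r" "1 < capture_round \<sigma> r" by blast
  \<comment> \<open>\<open>card\<close> is 0 on infinite sets, so nonemptiness alone would not bound
    it below.\<close>
  have "finite (damaged \<sigma> r)"
    by (rule finite_subset[OF _ pair_finite_verts])
      (auto simp: damaged_def robber_play_verts[OF G r(1)])
  moreover have "r 0 \<in> damaged \<sigma> r"
    using r(2) by (auto simp: damaged_def one_enat_def intro!: exI[of _ 0])
  ultimately have "1 \<le> card (damaged \<sigma> r)"
    by (metis One_nat_def Suc_leI card_gt_0_iff empty_iff)
  then show "1 \<le> (SUP r \<in> {r. robber_play G r}. enat (card (damaged \<sigma> r)))"
    using r(1) by (intro SUP_upper2[of r]) (auto simp: one_enat_def)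
qed

section \<open>Graphs with a hub\<close>

text \<open>The structure shared by gear and accordion graphs that suffices for connectedness and
  for the upper bounds with one and two cops. The size and degree conditions behind the lower bounds
  come in \<open>sparse_hub_graph\<close>.\<close>

locale hub_graph =
  fixes G :: "'a pair_pre_digraph" and h :: 'a and A B :: "'a set"
  assumes verts: "pverts G = insert h (A \<union> B)"
    and fin_A: "finite A" and fin_B: "finite B"
    and disjoint: "h \<notin> A" "h \<notin> B" "A \<inter> B = {}"
    and arcs_sym: "(u, v) \<in> parcs G \<Longrightarrow> (v, u) \<in> parcs G"
    and hub_arc: "(h, v) \<in> parcs G \<longleftrightarrow> v \<in> A"
    and arc_A: "a \<in> A \<Longrightarrow> (a, v) \<in> parcs G \<Longrightarrow> v \<in> insert h B"
    and arc_B: "b \<in> B \<Longrightarrow> (b, v) \<in> parcs G \<Longrightarrow> v \<in> A"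
    and arc_verts: "(u, v) \<in> parcs G \<Longrightarrow> u \<in> pverts G"
    and no_isolated: "b \<in> B \<Longrightarrow> \<exists>a\<in>A. (b, a) \<in> parcs G"
begin

section \<open>Finiteness, simplicity and connectedness\<close>

lemma arc_to_hub: "a \<in> A \<Longrightarrow> (a, h) \<in> parcs G"
  using arcs_sym hub_arc by blast

lemma arc_verts2: "(u, v) \<in> parcs G \<Longrightarrow> v \<in> pverts G"
  using arcs_sym arc_verts by blast

lemma fin_verts: "finite (pverts G)"
  by (simp add: verts fin_A fin_B)

lemma card_verts: "card (pverts G) = Suc (card A + card B)"
  using disjoint fin_A fin_B by (simp add: verts card_Un_disjoint)

lemma pair_graph: "pair_graph G"
proof
  show "finite (parcs G)"
    by (rule finite_subset[of _ "pverts G \<times> pverts G"])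
      (auto simp: fin_verts intro: arc_verts arc_verts2)
  show "symmetric (with_proj G)"
    by (auto simp: symmetric_def sym_def intro: arcs_sym)
  \<comment> \<open>A loop would join two vertices on the same side of the bipartition.\<close>
  show "fst e \<noteq> snd e" if "e \<in> parcs G" for e
    using that arc_verts[of "fst e" "snd e"] hub_arc[of h] arc_A[of "fst e" "fst e"]
      arc_B[of "fst e" "fst e"] disjoint
    by (cases e) (auto simp: verts)
qed (auto simp: fin_verts intro: arc_verts arc_verts2)

text \<open>Every vertex reaches the hub in at most two steps, via \<open>A\<close> if it lies in
  \<open>B\<close>; symmetry turns this into walks between any two vertices.\<close>

lemma connected: "connected (with_proj G)"
proof -
  interpret pair_graph G by (rule pair_graph)
  have hub: "u \<rightarrow>\<^sup>*\<^bsub>with_proj G\<^esub> h" if "u \<in> pverts G" for u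
  proof -
    consider "u = h" | "u \<in> A" | "u \<in> B" using \<open>u \<in> pverts G\<close> verts by blast
    then show ?thesis
    proof cases
      case 1
      then show ?thesis using \<open>u \<in> pverts G\<close> by auto
    next
      case 2
      then show ?thesis using arc_to_hub by auto
    next
      case 3
      then obtain a where "a \<in> A" "(u, a) \<in> parcs G" using no_isolated by blast
      then show ?thesis using arc_to_hub by (metis adj_reachable_trans reachable_adjI)
    qed
  qed
  have sym: "symmetric (with_proj G)" by (rule pair_sym_arcs)
  show ?thesis
    unfolding connected_def
  proof (rule strongly_connectedI)
    fix u v assume "u \<in> verts (with_proj (mk_symmetric (with_proj G)))"
      "v \<in> verts (with_proj (mk_symmetric (with_proj G)))"
    then have "u \<rightarrow>\<^sup>*\<^bsub>with_proj G\<^esub> v"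
      using hub symmetric_reachable[OF sym] reachable_trans by (metis pverts_mk_symmetric with_proj_simps(1))
    then show "u \<rightarrow>\<^sup>*\<^bsub>with_proj (mk_symmetric (with_proj G))\<^esub> v"
      by (rule reachable_mk_symmetricI)
  qed (simp add: verts)
qed

text \<open>The cop waits at the hub and captures the robber one round after he first enters \<open>A\<close>.\<close>

lemma dmg_one_le: "dmg G 1 \<le> 1"
  unfolding one_enat_def
proof (rule dmg_leI)
  \<comment> \<open>\<open>find\<close> returns the earliest visit to \<open>A\<close>. Longer
    histories give the same vertex, so the cop leaves the hub at most once and then stands still,
    which makes the strategy legal.\<close>
  define \<sigma> :: "'a cop_strategy" where
    "\<sigma> = (\<lambda>rs. [case find (\<lambda>v. v \<in> A) rs of None \<Rightarrow> h | Some v \<Rightarrow> v])"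
  have find_append: "find P (xs @ ys) = (case find P xs of None \<Rightarrow> find P ys | Some v \<Rightarrow> Some v)"
    for P :: "'a \<Rightarrow> bool" and xs ys
    by (induction xs) auto
  show "\<sigma> \<in> cop_strategies G 1"
    unfolding cop_strategies_def
    by (auto simp: cops_at_def \<sigma>_def verts find_append move_def hub_arc split: option.splits)
  fix r assume r: "robber_play G r"
  have none: "find (\<lambda>v. v \<in> A) (map r [0..<t]) = None" if "\<And>s. s < t \<Longrightarrow> r s \<notin> A" for t
    using that by (auto simp: find_None_iff)
  have hub: "cops_at \<sigma> r t = [h]" if "\<And>s. s < t \<Longrightarrow> r s \<notin> A" for t
    using none[OF that] by (simp add: cops_at_def \<sigma>_def)
  have avoid: "r s \<notin> A" if "enat (Suc t) < capture_round \<sigma> r" "s \<le> t" for s t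
    using \<open>s \<le> t\<close>
  \<comment> \<open>Strong induction makes \<open>r s\<close> the first visit to \<open>A\<close>,
    hence the cop's target in round \<open>Suc s\<close>.\<close>
  proof (induction s rule: less_induct)
    case (less s)
    then have none_s: "find (\<lambda>v. v \<in> A) (map r [0..<s]) = None" by (intro none) auto
    show ?case
    proof
      assume "r s \<in> A"
      then have "cops_at \<sigma> r (Suc s) = [r s]"
        using none_s by (simp add: cops_at_def \<sigma>_def find_append)
      then have "captured_in \<sigma> r (Suc s)" by (simp add: captured_in_def)
      then have "capture_round \<sigma> r \<le> enat (Suc s)" by (rule capture_round_le)
      also have "\<dots> \<le> enat (Suc t)" using less.prems by simp
      finally show False using that(1) by simp
    qed
  qed
  \<comment> \<open>A robber in \<open>B\<close> can only move into \<open>A\<close>, so one who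
    avoids \<open>A\<close> cannot move at all; starting at the hub is fatal in round 0.\<close>
  have stay: "r s = r 0" if t: "enat (Suc t) < capture_round \<sigma> r" and "s \<le> t" for s t
    using \<open>s \<le> t\<close>
  proof (induction s)
    case (Suc s)
    have "r 0 \<noteq> h"
    proof
      assume "r 0 = h"
      then have "captured_in \<sigma> r 0" by (simp add: captured_in_def hub)
      then show False using t capture_round_le[of \<sigma> r 0] by (auto simp: zero_enat_def[symmetric])
    qed
    then have "r 0 \<in> B" using avoid[OF t, of 0] r verts by (auto simp: robber_play_def)
    then show ?case
      using Suc avoid[OF t Suc.prems] r arc_B by (metis Suc_leD move_def robber_play_def)
  qed simp
  have "damaged \<sigma> r \<subseteq> {r 0}" using stay by (auto simp: damaged_def)
  from card_mono[OF _ this] show "card (damaged \<sigma> r) \<le> 1" by simp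
qed

text \<open>In round 1 the second cop moves next to the robber's position in \<open>B\<close>. From then on the two
  cops dominate the closed neighbourhood of this position.\<close>

lemma capt_two_le: "capt G 2 \<le> 2"
  unfolding numeral_eq_enat
proof (rule capt_leI)
  \<comment> \<open>The second cop's target in round 1: the robber's vertex if it lies in
    \<open>A\<close>, a neighbour of it if it lies in \<open>B\<close>. The default \<open>h\<close>
    is always a legal move, and a robber at \<open>h\<close> is already captured.\<close>
  define f where "f v = (if v \<in> A then v else if v \<in> B then SOME a. a \<in> A \<and> (v, a) \<in> parcs G else h)" for v
  have f_B: "f b \<in> A \<and> (b, f b) \<in> parcs G" if "b \<in> B" for b
    using someI_ex[of "\<lambda>a. a \<in> A \<and> (b, a) \<in> parcs G"] no_isolated[OF that] that disjoint
    by (auto simp: f_def)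
  have f_hub: "move G h (f v)" for v
    using f_B[of v] by (auto simp: f_def move_def hub_arc)
  \<comment> \<open>Here \<open>w\<close> is the robber's position after round 1: the cop at
    \<open>f v\<close> takes it if possible, otherwise the hub cop does if \<open>w\<close> is in
    \<open>A\<close>. Later entries are ignored, so both cops stand still after round 2.\<close>
  define \<sigma> :: "'a cop_strategy" where
    "\<sigma> = (\<lambda>rs. case rs of [] \<Rightarrow> [h, h] | [v] \<Rightarrow> [h, f v]
       | v # w # _ \<Rightarrow> if move G (f v) w then [h, w] else if w \<in> A then [w, f v] else [h, f v])"
  have at0: "cops_at \<sigma> r 0 = [h, h]" and at1: "cops_at \<sigma> r 1 = [h, f (r 0)]" for r
    by (auto simp: cops_at_def \<sigma>_def)
  have at2: "cops_at \<sigma> r (Suc (Suc t)) =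
      (if move G (f (r 0)) (r 1) then [h, r 1] else if r 1 \<in> A then [r 1, f (r 0)] else [h, f (r 0)])" for r t
  proof -
    have "[0..<Suc (Suc t)] = 0 # 1 # [2..<Suc (Suc t)]"
      by (simp add: upt_conv_Cons numeral_2_eq_2 del: upt_Suc)
    then show ?thesis by (simp add: cops_at_def \<sigma>_def del: upt_Suc)
  qed
  show "\<sigma> \<in> cop_strategies G 2"
    unfolding cop_strategies_def
  proof (safe)
    fix r assume "robber_play G r"
    show "length (cops_at \<sigma> r 0) = 2" by (simp add: at0)
    show "v \<in> pverts G" if "v \<in> set (cops_at \<sigma> r 0)" for v
      using that by (simp add: at0 verts)
    fix t
    consider "t = 0" | "t = 1" | s where "t = Suc (Suc s)" by (metis One_nat_def not0_implies_Suc)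
    then show "list_all2 (move G) (cops_at \<sigma> r t) (cops_at \<sigma> r (Suc t))"
    proof cases
      case 1
      then show ?thesis using at1[of r] f_hub by (simp add: at0 move_def)
    next
      case 2
      then show ?thesis using at1[of r] at2[of r 0] by (auto simp: move_def hub_arc)
    next
      case 3
      then show ?thesis by (simp add: at2 move_def)
    qed
  qed
  fix r assume r: "robber_play G r"
  consider "r 0 = h" | "r 0 \<in> A" | "r 0 \<in> B"
    using robber_play_verts[OF pair_graph r, of 0] verts by blast
  then show "\<exists>t\<le>2. captured_in \<sigma> r t"
  proof cases
    case 1
    then show ?thesis by (intro exI[of _ 0]) (simp add: captured_in_def at0)
  next
    case 2
    then show ?thesis using at1[of r] by (intro exI[of _ 1]) (simp add: captured_in_def f_def)
  next
    case 3
    then have "r 1 = r 0 \<or> r 1 \<in> A"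
      using r arc_B by (metis One_nat_def move_def robber_play_def)
    moreover have "move G (f (r 0)) (r 0)" using f_B[OF 3] arcs_sym by (auto simp: move_def)
    ultimately show ?thesis
      using at2[of r 0] by (intro exI[of _ 2]) (auto simp: captured_in_def numeral_2_eq_2)
  qed
qed

end

text \<open>In the last assumption, the two vertices \<open>b\<close> and \<open>b'\<close> lie on 4-cycles through the hub.\<close>

locale sparse_hub_graph = hub_graph +
  assumes deg_A: "a \<in> A \<Longrightarrow> card {b\<in>B. (a, b) \<in> parcs G} \<le> 2"
    and deg_B: "b \<in> B \<Longrightarrow> card {a\<in>A. (b, a) \<in> parcs G} \<le> 2"
    and card_A: "3 \<le> card A" and card_B: "3 \<le> card B" and card_AB: "7 \<le> card A + card B"
    and two_flexible: "\<exists>b b'. b \<noteq> b' \<and>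
      {b, b'} \<subseteq> {b\<in>B. \<forall>a. \<exists>a'\<in>A. a' \<noteq> a \<and> (b, a') \<in> parcs G}"
begin

section \<open>Domination and dodging in sparse hub graphs\<close>

lemma card_nbrs_A:
  assumes "c \<in> A" shows "card {v\<in>B. move G c v} \<le> 2" "card {v\<in>A. move G c v} \<le> 1"
proof -
  have "{v\<in>B. move G c v} = {b\<in>B. (c, b) \<in> parcs G}" "{v\<in>A. move G c v} = {c}"
    using assms disjoint arc_A[OF assms] by (auto simp: move_def)
  then show "card {v\<in>B. move G c v} \<le> 2" "card {v\<in>A. move G c v} \<le> 1"
    using deg_A[OF assms] by simp_all
qed

lemma card_nbrs_B:
  assumes "c \<in> B" shows "card {v\<in>A. move G c v} \<le> 2" "card {v\<in>B. move G c v} \<le> 1"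
proof -
  have "{v\<in>A. move G c v} = {b\<in>A. (c, b) \<in> parcs G}" "{v\<in>B. move G c v} = {c}"
    using assms disjoint arc_B[OF assms] by (auto simp: move_def)
  then show "card {v\<in>A. move G c v} \<le> 2" "card {v\<in>B. move G c v} \<le> 1"
    using deg_B[OF assms] by simp_all
qed

lemma card_nbrs_hub: "card {v\<in>B. move G h v} = 0"
proof -
  have "{v\<in>B. move G h v} = {}" using disjoint by (auto simp: move_def hub_arc)
  then show ?thesis by (metis card.empty)
qed

text \<open>By counting. If one vertex is the hub, the other covers at most 2 of at least 3 vertices
  of \<open>B\<close>. Two vertices of \<open>B\<close> miss the hub, and two of \<open>A\<close>
  cover only themselves in \<open>A\<close>. One of each covers at most 3 vertices in
  \<open>A\<close> and 3 in \<open>B\<close>, fewer than the required 7.\<close>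

lemma not_dominated:
  assumes "c \<in> pverts G" "d \<in> pverts G"
  shows "\<exists>v\<in>pverts G. \<not> move G c v \<and> \<not> move G d v"
proof (rule ccontr)
  assume "\<not> ?thesis"
  then have dom: "move G c v \<or> move G d v" if "v \<in> pverts G" for v using that by blast
  have le: "card X \<le> card {v\<in>X. move G c v} + card {v\<in>X. move G d v}" if "X \<subseteq> pverts G" for X
  proof -
    have "X = {v\<in>X. move G c v} \<union> {v\<in>X. move G d v}" using dom that by blast
    then show ?thesis using card_Un_le by metis
  qed
  have le_A: "card A \<le> card {v\<in>A. move G c v} + card {v\<in>A. move G d v}"
    and le_B: "card B \<le> card {v\<in>B. move G c v} + card {v\<in>B. move G d v}"
    using verts by (auto intro!: le)
  have small: "card {v\<in>B. move G x v} \<le> 2" if "x \<in> pverts G" for x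
    using that card_nbrs_A[of x] card_nbrs_B[of x] card_nbrs_hub by (auto simp: verts)
  have "c \<noteq> h" "d \<noteq> h"
    using le_B small assms card_B card_nbrs_hub by fastforce+
  moreover have "c \<notin> B \<or> d \<notin> B"
    using dom[of h] disjoint arc_B verts by (auto simp: move_def)
  ultimately consider "c \<in> A" "d \<in> A" | "c \<in> A" "d \<in> B" | "c \<in> B" "d \<in> A"
    using assms by (auto simp: verts)
  then show False
  proof cases
    case 1
    then show False using le_A card_nbrs_A(2)[of c] card_nbrs_A(2)[of d] card_A by simp
  next
    case 2
    then show False
      using le_A le_B card_nbrs_A[of c] card_nbrs_B[of d] card_AB by simp
  next
    case 3
    then show False
      using le_A le_B card_nbrs_A[of d] card_nbrs_B[of c] card_AB by simp
  qed
qed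

lemma two_le_capt_two: "2 \<le> capt G 2"
proof (rule two_le_capt)
  fix cs assume "length cs = 2" "set cs \<subseteq> pverts G"
  then obtain c d where "cs = [c, d]" "c \<in> pverts G" "d \<in> pverts G"
    by (auto simp: length_Suc_conv numeral_2_eq_2)
  then show "\<exists>v\<in>pverts G. \<forall>c\<in>set cs. \<not> move G c v"
    using not_dominated by auto
qed (simp add: verts)

text \<open>Against a cop starting in \<open>A\<close>, the robber takes a vertex of
  \<open>B\<close> not adjacent to the cop and stays: a single move cannot bring the cop next to it.
  Against a cop at \<open>h\<close> or in \<open>B\<close>, the robber takes a vertex of
  \<open>B\<close> on a 4-cycle through the hub and, when threatened from \<open>A\<close>, steps to
  another neighbour in \<open>A\<close>.\<close>

lemma three_le_capt_one: "3 \<le> capt G 1"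
proof (rule three_le_capt_one_if_dodge)
  fix c assume c: "c \<in> pverts G"
  show "\<exists>v\<in>pverts G. \<not> move G c v \<and>
    (\<forall>c'. move G c c' \<longrightarrow> (\<exists>v'. move G v v' \<and> \<not> move G c' v'))"
  proof (cases "c \<in> A")
    case True
    have "card {v\<in>B. move G c v} < card B" using card_nbrs_A(1)[OF True] card_B by simp
    then obtain v where v: "v \<in> B" "\<not> move G c v"
      by (metis (no_types, lifting) Collect_mem_eq less_irrefl Collect_cong)
    have "\<not> move G c' v" if "move G c c'" for c'
      using that v True arc_A[of c c'] arc_B[of c'] hub_arc disjoint by (auto simp: move_def)
    with v show ?thesis by (intro bexI[of _ v]) (auto simp: verts move_def)
  next
    case False
    \<comment> \<open>Of the two such vertices at least one differs from \<open>c\<close>.\<close>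
    obtain v where v: "v \<in> B" "v \<noteq> c" "\<And>a. \<exists>a'\<in>A. a' \<noteq> a \<and> (v, a') \<in> parcs G"
      using two_flexible by auto
    have nm: "\<not> move G c v"
      using v c False disjoint arc_B hub_arc by (auto simp: move_def verts)
    have "\<exists>v'. move G v v' \<and> \<not> move G c' v'" if c': "move G c c'" for c'
    proof (cases "move G c' v")
      case True
      then have "(v, c') \<in> parcs G" using c' nm arcs_sym by (auto simp: move_def)
      then have A: "c' \<in> A" using v arc_B by blast
      obtain a where a: "a \<in> A" "a \<noteq> c'" "(v, a) \<in> parcs G" using v(3) by blast
      \<comment> \<open>Both \<open>a\<close> and \<open>c'\<close> lie in \<open>A\<close>, which
        is independent.\<close>
      then have "\<not> move G c' a" using arc_A[OF A] disjoint by (auto simp: move_def)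
      with a show ?thesis by (auto simp: move_def)
    qed (auto simp: move_def)
    with nm v show ?thesis by (auto simp: verts)
  qed
qed (simp add: verts)

section \<open>The two throttling numbers\<close>

lemma th_d_eq: "th_d G = 2"
proof (rule antisym)
  have "th_d G \<le> enat 1 + dmg G 1"
    unfolding th_d_def by (rule INF_lower) (simp add: card_verts)
  also have "\<dots> \<le> enat 1 + 1" by (intro add_left_mono dmg_one_le)
  finally show "th_d G \<le> 2" by (simp add: one_enat_def numeral_eq_enat numeral_2_eq_2)
  show "2 \<le> th_d G"
    unfolding th_d_def
  proof (rule INF_greatest)
    fix k assume "k \<in> {1..card (pverts G)}"
    \<comment> \<open>One cop must concede a damaged vertex since capture takes more than one round;
      from two cops on, their number alone suffices.\<close>
    then consider "k = 1" | "2 \<le> k" by fastforce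
    then show "2 \<le> enat k + dmg G k"
    proof cases
      case 1
      have "2 \<le> capt G 1"
        using three_le_capt_one by (rule order_trans[rotated]) (simp add: numeral_eq_enat)
      then have "enat 1 + 1 \<le> enat 1 + dmg G 1"
        by (intro add_left_mono one_le_dmg pair_graph)
      then show ?thesis using 1 by (simp add: one_enat_def numeral_eq_enat numeral_2_eq_2)
    next
      case 2
      then have "2 \<le> enat k" by (simp add: numeral_eq_enat)
      then show ?thesis by (rule order_trans) simp
    qed
  qed
qed

lemma th_c_eq: "th_c G = 4"
proof (rule antisym)
  have "th_c G \<le> enat 2 + capt G 2"
    unfolding th_c_def using card_A by (intro INF_lower) (simp add: card_verts)
  also have "\<dots> \<le> enat 2 + 2" by (intro add_left_mono capt_two_le)
  finally show "th_c G \<le> 4" by (simp add: numeral_eq_enat)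
  show "4 \<le> th_c G"
    unfolding th_c_def
  proof (rule INF_greatest)
    fix k assume "k \<in> {1..card (pverts G)}"
    \<comment> \<open>The bounds are 1 + 3, 2 + 2 and 3 + 1, the last because there are at least 8
      vertices; four cops cost 4 by themselves.\<close>
    then consider "k = 1" | "k = 2" | "k = 3" | "4 \<le> k" by fastforce
    then show "4 \<le> enat k + capt G k"
    proof cases
      case 1
      have "enat 1 + 3 \<le> enat 1 + capt G 1" by (intro add_left_mono three_le_capt_one)
      then show ?thesis using 1 by (simp add: numeral_eq_enat)
    next
      case 2
      have "enat 2 + 2 \<le> enat 2 + capt G 2" by (intro add_left_mono two_le_capt_two)
      then show ?thesis using 2 by (simp add: numeral_eq_enat)
    next
      case 3
      have "enat 3 + 1 \<le> enat 3 + capt G 3"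
        using card_AB by (intro add_left_mono one_le_capt fin_verts) (simp add: card_verts)
      then show ?thesis using 3 by (simp add: numeral_eq_enat one_enat_def)
    next
      case 4
      then have "4 \<le> enat k" by (simp add: numeral_eq_enat)
      then show ?thesis by (rule order_trans) simp
    qed
  qed
qed

end

section \<open>Gear and accordion graphs\<close>

lemma card_parity_less:
  "card {i. i < n \<and> even i} = Suc n div 2" "card {i. i < n \<and> odd i} = n div 2" for n :: nat
proof (induction n)
  case (Suc n)
  have "{i. i < Suc n \<and> even i} = (if even n then insert n {i. i < n \<and> even i} else {i. i < n \<and> even i})"
    "{i. i < Suc n \<and> odd i} = (if even n then {i. i < n \<and> odd i} else insert n {i. i < n \<and> odd i})"
    by (auto simp: less_Suc_eq)
  with Suc show "card {i. i < Suc n \<and> even i} = Suc (Suc n) div 2"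
    "card {i. i < Suc n \<and> odd i} = Suc n div 2"
    by auto
qed simp_all

lemma card_le_2_if_subset: "X \<subseteq> {x, y} \<Longrightarrow> card X \<le> 2"
  by (rule order_trans[OF card_mono]) (auto simp: card_insert_if)

section \<open>The gear graph\<close>

lemma gear_arc_iff:
  assumes "0 < l"
  shows "(u, v) \<in> parcs (gear_graph l) \<longleftrightarrow>
    u < 2 * l \<and> v = (if Suc u = 2 * l then 0 else Suc u) \<or>
    v < 2 * l \<and> u = (if Suc v = 2 * l then 0 else Suc v) \<or>
    u = 2 * l \<and> v < 2 * l \<and> even v \<or> v = 2 * l \<and> u < 2 * l \<and> even u"
proof -
  have "Suc i mod (2 * l) = (if Suc i = 2 * l then 0 else Suc i)" if "i < 2 * l" for i
    using that by auto
  then show ?thesis by (auto simp: gear_graph_def graph_of_def simp del: mod_Suc)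
qed

text \<open>The cycle has even length, so its closing edge from \<open>2 * l - 1\<close> to 0 also
  changes parity.\<close>

lemma gear_arc_parity:
  assumes "0 < l" "(u, v) \<in> parcs (gear_graph l)" "u < 2 * l" "v < 2 * l"
  shows "even v \<longleftrightarrow> odd u"
proof -
  have "odd i" if "Suc i = 2 * l" for i using that by (metis dvd_triv_left even_Suc)
  moreover from this have "even i" if "Suc (Suc i) = 2 * l" for i using that by fastforce
  ultimately show ?thesis using assms by (auto simp: gear_arc_iff split: if_splits)
qed

lemma gear_arc_cycle:
  assumes "(u, v) \<in> parcs (gear_graph l)" "u < 2 * l" "v < 2 * l"
  shows "v \<in> {if u = 0 then 2 * l - 1 else u - 1, if Suc u = 2 * l then 0 else Suc u}"
proof -
  have "0 < l" using assms(2) by simp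
  with assms show ?thesis by (auto simp: gear_arc_iff split: if_splits)
qed

lemma gear_hub_graph:
  assumes "4 \<le> l"
  shows "sparse_hub_graph (gear_graph l) (2 * l) {i. i < 2 * l \<and> even i} {i. i < 2 * l \<and> odd i}"
    (is "sparse_hub_graph ?G ?h ?A ?B")
proof -
  have l: "0 < l" using assms by simp
  note arc = gear_arc_iff[OF l]
  show ?thesis
  proof
    show V: "pverts ?G = insert ?h (?A \<union> ?B)"
      by (auto simp: gear_graph_def graph_of_def)
    show sym: "(v, u) \<in> parcs ?G" if "(u, v) \<in> parcs ?G" for u v
      using that unfolding arc by blast
    have le: "u \<le> 2 * l" if "(u, v) \<in> parcs ?G" for u v
      using that l unfolding arc by (auto split: if_splits)
    show "u \<in> pverts ?G" if "(u, v) \<in> parcs ?G" for u v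
      using le[OF that] unfolding V by auto
    show hub: "(?h, v) \<in> parcs ?G \<longleftrightarrow> v \<in> ?A" for v
      unfolding arc by auto
    show "v \<in> insert ?h ?B" if "c \<in> ?A" "(c, v) \<in> parcs ?G" for c v
      using that gear_arc_parity[OF l that(2)] le[OF sym[OF that(2)]] by auto
    show "v \<in> ?A" if "c \<in> ?B" "(c, v) \<in> parcs ?G" for c v
      using that gear_arc_parity[OF l that(2)] le[OF sym[OF that(2)]] hub[of c] sym[OF that(2)]
      by (cases "v = ?h") auto
    show "\<exists>a\<in>?A. (c, a) \<in> parcs ?G" if "c \<in> ?B" for c
      using that unfolding arc by (intro bexI[of _ "c - 1"]) (auto elim!: oddE)
    show "card {v \<in> ?B. (c, v) \<in> parcs ?G} \<le> 2" if "c \<in> ?A" for c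
      using gear_arc_cycle[of c _ l] that by (intro card_le_2_if_subset) blast
    show "card {v \<in> ?A. (c, v) \<in> parcs ?G} \<le> 2" if "c \<in> ?B" for c
      using gear_arc_cycle[of c _ l] that by (intro card_le_2_if_subset) blast
    \<comment> \<open>Vertices 1 and 3 have the neighbours 0, 2 and 2, 4 in \<open>?A\<close>; at
      least one of the two differs from \<open>a\<close>.\<close>
    have "\<exists>a'\<in>?A. a' \<noteq> a \<and> (c, a') \<in> parcs ?G" if "c = 1 \<or> c = 3" for a c
      using that assms unfolding arc
      by (intro bexI[of _ "if a = c - 1 then c + 1 else c - 1"]) auto
    then show "\<exists>c c'. c \<noteq> c' \<and> {c, c'} \<subseteq> {c \<in> ?B. \<forall>a. \<exists>a'\<in>?A. a' \<noteq> a \<and> (c, a') \<in> parcs ?G}"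
      using assms by - (rule exI[of _ 1], rule exI[of _ 3], simp)
    show "3 \<le> card ?A" "3 \<le> card ?B" "7 \<le> card ?A + card ?B"
      using assms by (simp_all add: card_parity_less)
  qed auto
qed

section \<open>The accordion graphs\<close>

lemma accordion_arc_iff:
  "(u, v) \<in> parcs (accordion_graph b l) \<longleftrightarrow>
    Suc u < 2 * l - 1 \<and> v = Suc u \<or> Suc v < 2 * l - 1 \<and> u = Suc v \<or>
    u = 2 * l - 1 \<and> v < 2 * l - 1 \<and> (even v \<longleftrightarrow> b) \<or> v = 2 * l - 1 \<and> u < 2 * l - 1 \<and> (even u \<longleftrightarrow> b)"
  by (auto simp: accordion_graph_def graph_of_def)

text \<open>The two sides of the path have \<open>l\<close> and \<open>l - 1\<close> vertices, in an
  order depending on \<open>b\<close>; the bound on \<open>l\<close> gives exactly the required 3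
  and 7.\<close>

lemma accordion_hub_graph:
  assumes "4 \<le> l"
  shows "sparse_hub_graph (accordion_graph b l) (2 * l - 1)
    {i. i < 2 * l - 1 \<and> (even i \<longleftrightarrow> b)} {i. i < 2 * l - 1 \<and> (even i \<longleftrightarrow> \<not> b)}"
    (is "sparse_hub_graph ?G ?h ?A ?B")
proof -
  note arc = accordion_arc_iff
  have card: "card ?A = (if b then l else l - 1)" "card ?B = (if b then l - 1 else l)"
    using card_parity_less[of "2 * l - 1"] assms by (cases b; simp; linarith)+
  show ?thesis
  proof
    show V: "pverts ?G = insert ?h (?A \<union> ?B)"
      using assms by (auto simp: accordion_graph_def graph_of_def)
    show "(v, u) \<in> parcs ?G" if "(u, v) \<in> parcs ?G" for u v
      using that unfolding arc by blast
    show "u \<in> pverts ?G" if "(u, v) \<in> parcs ?G" for u v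
      using that unfolding V arc by auto
    show "(?h, v) \<in> parcs ?G \<longleftrightarrow> v \<in> ?A" for v
      unfolding arc by auto
    show "v \<in> insert ?h ?B" if "c \<in> ?A" "(c, v) \<in> parcs ?G" for c v
      using that unfolding arc by auto
    show "v \<in> ?A" if "c \<in> ?B" "(c, v) \<in> parcs ?G" for c v
      using that unfolding arc by auto
    show "\<exists>a\<in>?A. (c, a) \<in> parcs ?G" if "c \<in> ?B" for c
      \<comment> \<open>For \<open>b = False\<close> the end 0 of the path lies in
        \<open>?B\<close>, and 1 is its only neighbour.\<close>
      using that assms unfolding arc by (intro bexI[of _ "if c = 0 then 1 else c - 1"]) auto
    show "card {v \<in> ?B. (c, v) \<in> parcs ?G} \<le> 2" if "c \<in> ?A" for c
      by (rule card_le_2_if_subset[of _ "Suc c" "c - 1"]) (use that in \<open>auto simp: arc\<close>)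
    show "card {v \<in> ?A. (c, v) \<in> parcs ?G} \<le> 2" if "c \<in> ?B" for c
      by (rule card_le_2_if_subset[of _ "Suc c" "c - 1"]) (use that in \<open>auto simp: arc\<close>)
    \<comment> \<open>An inner path vertex has two path neighbours, both in \<open>?A\<close>; the
      bounds exclude the ends.\<close>
    have flexible: "\<exists>a'\<in>?A. a' \<noteq> a \<and> (c, a') \<in> parcs ?G"
      if "c \<in> ?B" "0 < c" "Suc c < 2 * l - 1" for a c
      using that unfolding arc by (intro bexI[of _ "if a = c - 1 then c + 1 else c - 1"]) auto
    \<comment> \<open>The first inner path vertex in \<open>?B\<close>; \<open>c + 2\<close> is the
      next one.\<close>
    define c :: nat where "c = (if b then 1 else 2)"
    have c: "c \<in> ?B" "0 < c" "Suc c < 2 * l - 1" "c + 2 \<in> ?B" "Suc (c + 2) < 2 * l - 1"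
      using assms by (auto simp: c_def)
    show "\<exists>c c'. c \<noteq> c' \<and> {c, c'} \<subseteq> {c \<in> ?B. \<forall>a. \<exists>a'\<in>?A. a' \<noteq> a \<and> (c, a') \<in> parcs ?G}"
      using flexible[OF c(1-3)] flexible[OF c(4) _ c(5)] c(1,4)
      by - (rule exI[of _ c], rule exI[of _ "c + 2"], simp)
    show "3 \<le> card ?A" "3 \<le> card ?B" "7 \<le> card ?A + card ?B"
      using assms card by auto
  qed auto
qed

section \<open>Infinitely many non-isomorphic examples\<close>

lemma digraph_iso_card_verts:
  assumes "digraph_iso G H"
  shows "card (verts G) = card (verts H)"
  using assms
  by (auto simp: digraph_iso_def card_image pre_digraph.digraph_isomorphism_inj_on_verts)

text \<open>The difference is expressed by addition because subtraction on \<open>enat\<close> is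
  truncated. Pairwise non-isomorphism ensures that the family is infinite beyond mere
  relabelling.\<close>

theorem theorem3p5:
  shows "(\<forall>l\<ge>4. \<forall>G. G = gear_graph l \<or> (\<exists>b. G = accordion_graph b l) \<longrightarrow>
            th_d G + 2 = th_c G) \<and>
         (\<exists>\<G> :: nat pair_pre_digraph set. infinite \<G> \<and>
            pairwise (\<lambda>G H. \<not> digraph_iso (with_proj G) (with_proj H)) \<G> \<and>
            (\<forall>G\<in>\<G>. pair_graph G \<and> connected (with_proj G) \<and> th_d G + 1 < th_c G))"
proof (intro conjI allI impI)
  fix l :: nat and G assume "4 \<le> l" "G = gear_graph l \<or> (\<exists>b. G = accordion_graph b l)"
  then obtain h A B where "sparse_hub_graph G h A B"
    using gear_hub_graph accordion_hub_graph by blast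
  then show "th_d G + 2 = th_c G"
    by (simp add: sparse_hub_graph.th_d_eq sparse_hub_graph.th_c_eq)
next
  have card: "card (pverts (gear_graph l)) = Suc (2 * l)" for l
    by (simp add: gear_graph_def graph_of_def)
  show "\<exists>\<G> :: nat pair_pre_digraph set. infinite \<G> \<and>
      pairwise (\<lambda>G H. \<not> digraph_iso (with_proj G) (with_proj H)) \<G> \<and>
      (\<forall>G\<in>\<G>. pair_graph G \<and> connected (with_proj G) \<and> th_d G + 1 < th_c G)"
  \<comment> \<open>The order \<open>2 * l + 1\<close> determines \<open>l\<close>, which gives both
    injectivity and non-isomorphism.\<close>
  proof (intro exI[of _ "gear_graph ` {4..}"] conjI ballI)
    have "inj gear_graph" by (rule injI) (metis Suc_inject card mult_cancel1 zero_neq_numeral)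
    then show "infinite (gear_graph ` {4..})"
      by (simp add: finite_image_iff inj_on_subset infinite_Ici)
    show "pairwise (\<lambda>G H. \<not> digraph_iso (with_proj G) (with_proj H)) (gear_graph ` {4..})"
      using card by (auto simp: pairwise_def dest!: digraph_iso_card_verts)
  next
    fix G assume "G \<in> gear_graph ` {4..}"
    then obtain h A B where "sparse_hub_graph G h A B"
      using gear_hub_graph by blast
    then interpret sparse_hub_graph G h A B .
    show "pair_graph G" by (rule pair_graph)
    show "connected (with_proj G)" by (rule connected)
    show "th_d G + 1 < th_c G" by (simp add: th_d_eq th_c_eq one_enat_def numeral_eq_enat)
  qed
qed

end
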